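(* Let $K\ge3$, let $1=s_1\le s_2\le\cdots\le s_K$ be real numbers and let $c_1,\dots,c_K$ be nonzero real numbers with $\sum_{k=1}^K c_k^2=1$. Let $$f'(\lambda)=1-\sum_{k=1}^K\frac{c_k^2}{(\lambda-s_k)^2},$$ and let $\lambda^\star$ be the root of $f'$ in $[0,1-|c_1|]$. For $1\le L\le K-2$ put $\tilde c_{L+1}=\sqrt{\sum_{k=L+1}^K c_k^2}$ and $$f^{(L)}_{l}(\lambda)=1-\sum_{j=1}^{L}\frac{c_j^2}{(s_j-\lambda)^2}-\frac{\tilde c_{L+1}^2}{(s_{L+1}-\lambda)^2},\qquad f^{(L)}_{u}(\lambda)=1-\sum_{j=1}^{L}\frac{c_j^2}{(s_j-\lambda)^2}-\frac{\tilde c_{L+1}^2}{(s_{K}-\lambda)^2}.$$ Then for each $L$ the function $f^{(L)}_l$ has a unique root $\lambda_{l,L}^\star$ in $[0,1-|c_1|]$, the function $f^{(L)}_u$ has a unique root $\lambda_{u,L}^\star$ in $[0,1-|c_1|]$, and $$\lambda_{l,1}^\star\le\lambda_{l,2}^\star\le\cdots\le\lambda_{l,K-2}^\star\le\lambda^\star\le\lambda_{u,K-2}^\star\le\cdots\le\lambda_{u,2}^\star\le\lambda_{u,1}^\star .$$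
   Context: The function $f'$ is the derivative of $f(\lambda)=\lambda+\sum_{k=1}^K c_k^2/(\lambda-s_k)$; it has exactly one root smaller than $s_1=1$, and that root, denoted $\lambda^\star$, lies in $[0,1-|c_1|]$. *)

theory Defs
  imports Complex_Main
begin

text \<open>
  Sequences \<open>s\<close>, \<open>c\<close> are functions on \<open>nat\<close>, of which only the values at \<open>1, \<dots>, K\<close> matter.
  The value of the following functions at a pole is irrelevant: on \<open>[0, 1 - \<bar>c 1\<bar>]\<close> with
  \<open>c 1 \<noteq> 0\<close> and \<open>s k \<ge> 1\<close> no denominator vanishes.
\<close>

definition secular :: "nat \<Rightarrow> (nat \<Rightarrow> real) \<Rightarrow> (nat \<Rightarrow> real) \<Rightarrow> real \<Rightarrow> real" where
  "secular K s c x = x + (\<Sum>k=1..K. (c k)\<^sup>2 / (x - s k))"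

definition secular' :: "nat \<Rightarrow> (nat \<Rightarrow> real) \<Rightarrow> (nat \<Rightarrow> real) \<Rightarrow> real \<Rightarrow> real" where
  "secular' K s c x = 1 - (\<Sum>k=1..K. (c k)\<^sup>2 / (x - s k)\<^sup>2)"

lemma has_real_derivative_secular:
  assumes "\<And>k. k \<in> {1..K} \<Longrightarrow> x \<noteq> s k"
  shows "(secular K s c has_real_derivative secular' K s c x) (at x)"
  unfolding secular_def [abs_def] secular'_def
  by (rule derivative_eq_intros refl | use assms in force)+
     (simp add: power2_eq_square sum_negf)

definition c_tail :: "nat \<Rightarrow> (nat \<Rightarrow> real) \<Rightarrow> nat \<Rightarrow> real" where
  "c_tail K c m = sqrt (\<Sum>k=m..K. (c k)\<^sup>2)"

definition f_lower :: "nat \<Rightarrow> (nat \<Rightarrow> real) \<Rightarrow> (nat \<Rightarrow> real) \<Rightarrow> nat \<Rightarrow> real \<Rightarrow> real" where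
  "f_lower K s c L x =
     1 - (\<Sum>j=1..L. (c j)\<^sup>2 / (s j - x)\<^sup>2) - (c_tail K c (L + 1))\<^sup>2 / (s (L + 1) - x)\<^sup>2"

definition f_upper :: "nat \<Rightarrow> (nat \<Rightarrow> real) \<Rightarrow> (nat \<Rightarrow> real) \<Rightarrow> nat \<Rightarrow> real \<Rightarrow> real" where
  "f_upper K s c L x =
     1 - (\<Sum>j=1..L. (c j)\<^sup>2 / (s j - x)\<^sup>2) - (c_tail K c (L + 1))\<^sup>2 / (s K - x)\<^sup>2"

text \<open>Meaningful only for a function with exactly one root in \<open>I\<close>.\<close>

definition root_in :: "real set \<Rightarrow> (real \<Rightarrow> real) \<Rightarrow> real" where
  "root_in I g = (THE x. x \<in> I \<and> g x = 0)"

end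

theory Submission
  imports Defs
begin

text \<open>
  All functions involved are of one kind. Since the weights \<open>(c k)\<^sup>2\<close> with \<open>k > L\<close> add up to the
  squared tail \<open>(c_tail K c (L + 1))\<^sup>2\<close>, both \<open>f_lower\<close> and \<open>f_upper\<close> are the function
  \<open>secular'\<close> with the same weights \<open>c\<close> but other poles, all poles with index above \<open>L\<close> having
  been moved together, down to \<open>s (L + 1)\<close> in the first case and up to \<open>s K\<close> in the second
  (\<open>f_lower_eq_secular'\<close>, \<open>f_upper_eq_secular'\<close>).

  So let \<open>t\<close> be any sequence of poles with \<open>t 1 = 1\<close> and \<open>t k \<ge> 1\<close>. Left of \<open>1\<close> every summand
  \<open>(c k)\<^sup>2 / (x - t k)\<^sup>2\<close> grows when \<open>x\<close> moves right, towards the pole, and shrinks when the pole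
  moves right, away from \<open>x\<close>. Hence \<open>secular' K t c x\<close> is strictly decreasing in \<open>x\<close> and increasing
  in \<open>t\<close>. It is nonnegative at \<open>0\<close>, because the weights add up to \<open>1\<close> and no pole is closer to
  \<open>0\<close> than \<open>1\<close>; it is nonpositive at \<open>1 - \<bar>c 1\<bar>\<close>, where the first summand alone equals \<open>1\<close>. This
  gives a unique root (\<open>ex1_root_secular'\<close>), and monotonicity in \<open>t\<close> says that moving poles to the
  right moves the root to the right (\<open>secular'_root_mono\<close>).

  The chain of inequalities is then the chain of pointwise inequalities between the pole sequences
  \<open>s (min k (L + 1)) \<le> s (min k (L + 2)) \<le> s k \<le> (if k \<le> L + 1 then s k else s K) \<le> (if k \<le> L then s k
  else s K)\<close>.
\<close>

section \<open>The secular derivative with arbitrary poles\<close>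

lemma secular'_strict_decreasing:
  fixes t c :: "nat \<Rightarrow> real"
  assumes "K \<ge> 1" and "c 1 \<noteq> 0" and "\<And>k. k \<in> {1..K} \<Longrightarrow> t k \<ge> 1"
    and "x < y" and "y < 1"
  shows "secular' K t c y < secular' K t c x"
proof -
  have sq: "(x - t k)\<^sup>2 > (y - t k)\<^sup>2 \<and> (y - t k)\<^sup>2 > 0" if "k \<in> {1..K}" for k
  proof -
    have "0 < t k - y" "t k - y < t k - x" using assms(3)[OF that] assms(4,5) by auto
    then have "0 < (t k - y)\<^sup>2" "(t k - y)\<^sup>2 < (t k - x)\<^sup>2"
      by (auto intro: power_strict_mono)
    then show ?thesis by (simp add: power2_commute)
  qed
  have "(\<Sum>k=1..K. (c k)\<^sup>2 / (x - t k)\<^sup>2) < (\<Sum>k=1..K. (c k)\<^sup>2 / (y - t k)\<^sup>2)"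
  proof (rule sum_strict_mono_ex1)
    show "\<forall>k\<in>{1..K}. (c k)\<^sup>2 / (x - t k)\<^sup>2 \<le> (c k)\<^sup>2 / (y - t k)\<^sup>2"
    proof
      fix k assume "k \<in> {1..K}"
      then have "0 < (y - t k)\<^sup>2" "(y - t k)\<^sup>2 < (x - t k)\<^sup>2" using sq by blast+
      then show "(c k)\<^sup>2 / (x - t k)\<^sup>2 \<le> (c k)\<^sup>2 / (y - t k)\<^sup>2"
        by (intro divide_left_mono mult_pos_pos zero_le_power2) linarith+
    qed
    have "(c 1)\<^sup>2 / (x - t 1)\<^sup>2 < (c 1)\<^sup>2 / (y - t 1)\<^sup>2"
      using sq[of 1] assms(1,2) by (intro divide_strict_left_mono) (auto intro!: mult_pos_pos)
    then show "\<exists>k\<in>{1..K}. (c k)\<^sup>2 / (x - t k)\<^sup>2 < (c k)\<^sup>2 / (y - t k)\<^sup>2"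
      using assms(1) by (intro bexI[of _ 1]) auto
  qed simp
  then show ?thesis by (simp add: secular'_def)
qed

lemma secular'_mono_poles:
  fixes t t' c :: "nat \<Rightarrow> real"
  assumes "\<And>k. k \<in> {1..K} \<Longrightarrow> x < t k" and "\<And>k. k \<in> {1..K} \<Longrightarrow> t k \<le> t' k"
  shows "secular' K t c x \<le> secular' K t' c x"
proof -
  have "(c k)\<^sup>2 / (x - t' k)\<^sup>2 \<le> (c k)\<^sup>2 / (x - t k)\<^sup>2" if k: "k \<in> {1..K}" for k
  proof -
    have "0 < t k - x" "t k - x \<le> t' k - x" using assms k by force+
    then have "(c k)\<^sup>2 / (t' k - x)\<^sup>2 \<le> (c k)\<^sup>2 / (t k - x)\<^sup>2"
      by (intro divide_left_mono power_mono mult_pos_pos zero_less_power) auto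
    then show ?thesis by (simp add: power2_commute)
  qed
  then have "(\<Sum>k=1..K. (c k)\<^sup>2 / (x - t' k)\<^sup>2) \<le> (\<Sum>k=1..K. (c k)\<^sup>2 / (x - t k)\<^sup>2)"
    by (rule sum_mono)
  then show ?thesis by (simp add: secular'_def)
qed

text \<open>
  If the root \<open>y\<close> for \<open>t'\<close> were left of \<open>x\<close>, the function with poles \<open>t\<close> would be at most \<open>0\<close> at
  \<open>y\<close>, hence negative at \<open>x\<close>.
\<close>

lemma secular'_root_mono:
  fixes t t' c :: "nat \<Rightarrow> real"
  assumes "K \<ge> 1" and "c 1 \<noteq> 0"
    and "\<And>k. k \<in> {1..K} \<Longrightarrow> t k \<ge> 1" and "\<And>k. k \<in> {1..K} \<Longrightarrow> t k \<le> t' k"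
    and "x < 1" and "secular' K t c x = 0" and "secular' K t' c y = 0"
  shows "x \<le> y"
proof (rule ccontr)
  assume "\<not> x \<le> y"
  then have "y < x" by simp
  then have "secular' K t c x < secular' K t c y"
    using assms by (intro secular'_strict_decreasing) auto
  also have "\<dots> \<le> secular' K t' c y"
  proof (rule secular'_mono_poles)
    show "y < t k" if "k \<in> {1..K}" for k
      using assms(3)[OF that] \<open>y < x\<close> assms(5) by simp
  qed (use assms(4) in auto)
  finally show False using assms by simp
qed

lemma ex1_root_secular':
  fixes t c :: "nat \<Rightarrow> real"
  assumes "K \<ge> 1" and "c 1 \<noteq> 0" and "(\<Sum>k=1..K. (c k)\<^sup>2) = 1"
    and "t 1 = 1" and t_ge: "\<And>k. k \<in> {1..K} \<Longrightarrow> t k \<ge> 1"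
  shows "\<exists>!x. x \<in> {0..1 - \<bar>c 1\<bar>} \<and> secular' K t c x = 0"
proof (rule ex_ex1I)
  let ?b = "1 - \<bar>c 1\<bar>"
  have "(c 1)\<^sup>2 \<le> (\<Sum>k=1..K. (c k)\<^sup>2)"
    using assms(1) by (intro member_le_sum) auto
  then have b: "0 \<le> ?b" using assms(3) by (simp add: abs_square_le_1)
  have "(\<Sum>k=1..K. (c k)\<^sup>2 / (0 - t k)\<^sup>2) \<le> (\<Sum>k=1..K. (c k)\<^sup>2)"
  proof (rule sum_mono)
    fix k assume "k \<in> {1..K}"
    then have "1 \<le> (t k)\<^sup>2" using t_ge by simp
    then show "(c k)\<^sup>2 / (0 - t k)\<^sup>2 \<le> (c k)\<^sup>2"
      using mult_left_mono[of 1 "(t k)\<^sup>2" "(c k)\<^sup>2"] by (simp add: divide_le_eq)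
  qed
  then have left: "0 \<le> secular' K t c 0"
    using assms(3) by (simp add: secular'_def)
  have "(c 1)\<^sup>2 / (?b - t 1)\<^sup>2 \<le> (\<Sum>k=1..K. (c k)\<^sup>2 / (?b - t k)\<^sup>2)"
    using assms(1) by (intro member_le_sum) auto
  then have right: "secular' K t c ?b \<le> 0"
    using assms(2,4) by (simp add: secular'_def)
  have cont: "continuous_on {0..?b} (secular' K t c)"
    unfolding secular'_def
  proof (intro continuous_intros ballI)
    fix k x assume "k \<in> {1..K}" "x \<in> {0..?b}"
    then show "(x - t k)\<^sup>2 \<noteq> 0" using t_ge[of k] assms(2) by auto
  qed
  show "\<exists>x. x \<in> {0..?b} \<and> secular' K t c x = 0"
    using IVT2'[OF right left b cont] by auto
next
  fix x y
  assume "x \<in> {0..1 - \<bar>c 1\<bar>} \<and> secular' K t c x = 0" "y \<in> {0..1 - \<bar>c 1\<bar>} \<and> secular' K t c y = 0"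
  moreover from this have "x < 1" "y < 1" using assms(2) by auto
  ultimately show "x = y"
    using secular'_root_mono[of K c t t] assms by (intro antisym) auto
qed

lemma root_in_root:
  assumes "\<exists>!x. x \<in> I \<and> g x = 0"
  shows "root_in I g \<in> I" and "g (root_in I g) = 0"
  using theI'[OF assms] by (simp_all add: root_in_def)

lemma root_in_secular'_mono:
  fixes t t' c :: "nat \<Rightarrow> real"
  assumes "K \<ge> 1" and "c 1 \<noteq> 0" and "(\<Sum>k=1..K. (c k)\<^sup>2) = 1"
    and "t 1 = 1" and "t' 1 = 1"
    and t_ge: "\<And>k. k \<in> {1..K} \<Longrightarrow> t k \<ge> 1" and le: "\<And>k. k \<in> {1..K} \<Longrightarrow> t k \<le> t' k"
  shows "root_in {0..1 - \<bar>c 1\<bar>} (secular' K t c) \<le> root_in {0..1 - \<bar>c 1\<bar>} (secular' K t' c)"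
proof -
  have "t' k \<ge> 1" if "k \<in> {1..K}" for k
    using t_ge[OF that] le[OF that] by simp
  then have t': "\<exists>!x. x \<in> {0..1 - \<bar>c 1\<bar>} \<and> secular' K t' c x = 0"
    using assms by (intro ex1_root_secular') auto
  have t: "\<exists>!x. x \<in> {0..1 - \<bar>c 1\<bar>} \<and> secular' K t c x = 0"
    using assms by (intro ex1_root_secular') auto
  have "root_in {0..1 - \<bar>c 1\<bar>} (secular' K t c) < 1"
    using root_in_root(1)[OF t] assms(2) by auto
  then show ?thesis
    using secular'_root_mono[of K c t t'] assms(1,2) t_ge le root_in_root(2)[OF t] root_in_root(2)[OF t']
    by blast
qed

section \<open>The bounding functions as secular derivatives\<close>

text \<open>Collapsing all poles with index above \<open>L\<close> to one point \<open>p\<close> merges their weights.\<close>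

lemma secular'_collapsed_tail:
  fixes s c :: "nat \<Rightarrow> real"
  assumes "L \<le> K"
  shows "secular' K (\<lambda>k. if k \<le> L then s k else p) c x =
    1 - (\<Sum>j=1..L. (c j)\<^sup>2 / (s j - x)\<^sup>2) - (c_tail K c (L + 1))\<^sup>2 / (p - x)\<^sup>2"
proof -
  have "(\<Sum>k=1..K. (c k)\<^sup>2 / (x - (if k \<le> L then s k else p))\<^sup>2) =
      (\<Sum>k=1..L. (c k)\<^sup>2 / (x - (if k \<le> L then s k else p))\<^sup>2) +
      (\<Sum>k=L+1..K. (c k)\<^sup>2 / (x - (if k \<le> L then s k else p))\<^sup>2)"
    using sum.ub_add_nat[of 1 L "\<lambda>k. (c k)\<^sup>2 / (x - (if k \<le> L then s k else p))\<^sup>2" "K - L"] assms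
    by (simp only: le_add_diff_inverse le_add2)
  also have "\<dots> = (\<Sum>k=1..L. (c k)\<^sup>2 / (s k - x)\<^sup>2) + (\<Sum>k=L+1..K. (c k)\<^sup>2 / (p - x)\<^sup>2)"
    by (intro arg_cong2[of _ _ _ _ "(+)"] sum.cong) (auto simp: power2_commute)
  also have "(\<Sum>k=L+1..K. (c k)\<^sup>2 / (p - x)\<^sup>2) = (c_tail K c (L + 1))\<^sup>2 / (p - x)\<^sup>2"
    by (simp add: c_tail_def sum_nonneg flip: sum_divide_distrib)
  finally show ?thesis by (simp add: secular'_def)
qed

lemma f_lower_eq_secular':
  assumes "L \<le> K"
  shows "f_lower K s c L = secular' K (\<lambda>k. s (min k (L + 1))) c"
proof -
  have "(\<lambda>k. s (min k (L + 1))) = (\<lambda>k. if k \<le> L then s k else s (L + 1))"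
    by (auto simp: min_def le_Suc_eq)
  then show ?thesis
    using secular'_collapsed_tail[OF assms] by (simp add: f_lower_def fun_eq_iff)
qed

lemma f_upper_eq_secular':
  assumes "L \<le> K"
  shows "f_upper K s c L = secular' K (\<lambda>k. if k \<le> L then s k else s K) c"
  using secular'_collapsed_tail[OF assms] by (simp add: f_upper_def fun_eq_iff)

section \<open>The ordering of the roots\<close>

theorem lemma5:
  fixes K :: nat and s c :: "nat \<Rightarrow> real" and lam :: real
  assumes "K \<ge> 3"
    and "s 1 = 1"
    and "mono_on {1..K} s"
    and "\<forall>k\<in>{1..K}. c k \<noteq> 0"
    and "(\<Sum>k=1..K. (c k)\<^sup>2) = 1"
    and "lam \<in> {0..1 - \<bar>c 1\<bar>}"
    and "secular' K s c lam = 0"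
  defines "I \<equiv> {0..1 - \<bar>c 1\<bar>}"
  shows "(\<forall>L\<in>{1..K - 2}. \<exists>!x. x \<in> I \<and> f_lower K s c L x = 0) \<and>
         (\<forall>L\<in>{1..K - 2}. \<exists>!x. x \<in> I \<and> f_upper K s c L x = 0) \<and>
         (\<forall>L\<in>{1..<K - 2}. root_in I (f_lower K s c L) \<le> root_in I (f_lower K s c (L + 1))) \<and>
         root_in I (f_lower K s c (K - 2)) \<le> lam \<and>
         lam \<le> root_in I (f_upper K s c (K - 2)) \<and>
         (\<forall>L\<in>{1..<K - 2}. root_in I (f_upper K s c (L + 1)) \<le> root_in I (f_upper K s c L))"
proof -
  have K: "K \<ge> 1" and c1: "c 1 \<noteq> 0" using assms(1,4) by auto
  have s_mono: "s i \<le> s j" if "1 \<le> i" "i \<le> j" "j \<le> K" for i j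
    using assms(3) that by (auto intro: mono_onD)
  have s_ge: "1 \<le> s k" if "1 \<le> k" "k \<le> K" for k
    using s_mono[of 1 k] assms(2) that by simp
  let ?low = "\<lambda>L k. s (min k (L + 1))" and ?upp = "\<lambda>L k. if k \<le> L then s k else s K"
  have low: "f_lower K s c L = secular' K (?low L) c"
    and upp: "f_upper K s c L = secular' K (?upp L) c" if "L \<le> K" for L
    using that by (rule f_lower_eq_secular', rule f_upper_eq_secular')
  note ex1 = ex1_root_secular'[OF K c1 assms(5), folded I_def]
  note root_mono = root_in_secular'_mono[where c = c, OF K c1 assms(5), folded I_def]
  have lam: "root_in I (secular' K s c) = lam"
    unfolding root_in_def using ex1[of s] assms(2,6,7) s_ge
    by (intro the1_equality) (auto simp: I_def)
  have "\<exists>!x. x \<in> I \<and> f_lower K s c L x = 0" if "L \<in> {1..K - 2}" for L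
    using that K assms(2) s_ge by (subst low) (auto intro!: ex1)
  moreover have "\<exists>!x. x \<in> I \<and> f_upper K s c L x = 0" if "L \<in> {1..K - 2}" for L
    using that K assms(2) s_ge by (subst upp) (auto intro!: ex1)
  moreover have "root_in I (f_lower K s c L) \<le> root_in I (f_lower K s c (L + 1))"
    if "L \<in> {1..<K - 2}" for L
  proof -
    have "root_in I (secular' K (?low L) c) \<le> root_in I (secular' K (?low (L + 1)) c)"
      using that assms(2) by (intro root_mono) (auto intro!: s_mono s_ge)
    then show ?thesis using that low[of L] low[of "L + 1"] by auto
  qed
  moreover have "root_in I (f_lower K s c (K - 2)) \<le> lam"
  proof -
    have "root_in I (secular' K (?low (K - 2)) c) \<le> root_in I (secular' K s c)"
      using assms(1,2) by (intro root_mono) (auto intro!: s_mono s_ge)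
    then show ?thesis by (simp add: low lam)
  qed
  moreover have "lam \<le> root_in I (f_upper K s c (K - 2))"
  proof -
    have "root_in I (secular' K s c) \<le> root_in I (secular' K (?upp (K - 2)) c)"
      using assms(1,2) by (intro root_mono) (auto intro!: s_mono s_ge)
    then show ?thesis by (simp add: upp lam)
  qed
  moreover have "root_in I (f_upper K s c (L + 1)) \<le> root_in I (f_upper K s c L)"
    if "L \<in> {1..<K - 2}" for L
  proof -
    have "root_in I (secular' K (?upp (L + 1)) c) \<le> root_in I (secular' K (?upp L) c)"
      using that assms(2) by (intro root_mono) (auto intro!: s_mono s_ge)
    then show ?thesis using that upp[of L] upp[of "L + 1"] by auto
  qed
  ultimately show ?thesis by blast
qed

end
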